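(* Let $0<a<\frac13$, let $\zeta_1,\zeta_2\in C^1(\mathbb{T}^2)$ be real-valued functions on $\mathbb{T}^2=\mathbb{R}^2/(2\pi\mathbb{Z})^2$, and for $\delta_1,\delta_2\in\mathbb{R}$ let $F,\widetilde F:\mathbb{T}^2\to\mathbb{T}^2$ be given by $$F(x,y)=\bigl(x+2a\sin x+a\sin y,\; y+a\sin x+2a\sin y\bigr)\pmod{2\pi},$$ $$\widetilde F(x,y)=F(x,y)+\bigl(\delta_1\zeta_1(x,y),\,\delta_2\zeta_2(x,y)\bigr)\pmod{2\pi}.$$ Let $S$ be the basin of attraction of the fixed point $(\pi,\pi)$ of $F$, and let $V$ be the Lyapunov function for $F$ constructed by Buescu, D'Aniello and Oliveira (arXiv:2502.15371), namely $$V(x,y)=|\pi-x|+|\pi-y|,\qquad (x,y)\in[0,2\pi[\times[0,2\pi[ .$$ Let $|\delta_1|+|\delta_2|$ be sufficiently small, so that $F$ and $\widetilde F$ are topologically conjugate, and let $h:\mathbb{T}^2\to\mathbb{T}^2$ be a topological conjugacy, i.e. a homeomorphism with $h\circ F=\widetilde F\circ h$. Then $h(\pi,\pi)$ is a sink for $\widetilde F$ with strict Lyapunov function $\widetilde V=V\circ h^{-1}$ on the open set $h(S)$.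
   Context: $F$ models the nearest-neighbour Huygens interaction of three identical clocks on a line, and $\widetilde F$ the perturbed (non-identical) case. Known facts about $F$ which form the setting: $F$ is a Morse-Smale diffeomorphism of $\mathbb{T}^2$ (finite nonwandering set made of hyperbolic fixed points or periodic orbits; all limit sets of orbits are fixed points or periodic orbits; stable and unstable manifolds intersect transversely), with unique hyperbolic attractor $\{(\pi,\pi)\}$, whose basin $S$ is open with $\overline S=\mathbb{T}^2$. A sink is a hyperbolic asymptotically stable fixed point. For a map $f$ and a continuous function $W$ on an open forward-invariant set $O$, the discrete orbital derivative is $\dot W(z)=W(f(z))-W(z)$; $W$ is a strict Lyapunov function for $f$ on $O$ for a fixed point $p\in O$ if $W(p)=0$, $W>0$ on $O\setminus\{p\}$, $\dot W\le 0$ on $O$ and $\dot W<0$ on $O\setminus\{p\}$. Here the fixed point for $\widetilde V$ is $h(\pi,\pi)$. *)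

theory Defs
  imports "HOL-Analysis.Analysis" "HOL-Library.Real_Mod"
begin

section \<open>The torus $\mathbb{R}^2/(2\pi\mathbb{Z})^2$\<close>

definition torus_rel :: "real \<times> real \<Rightarrow> real \<times> real \<Rightarrow> bool" where
  "torus_rel p q \<longleftrightarrow>
     [fst p = fst q] (rmod (2 * pi)) \<and> [snd p = snd q] (rmod (2 * pi))"

quotient_type torus = "real \<times> real" / torus_rel
  morphisms rep_torus torus_of
  by (rule equivpI)
    (auto intro!: reflpI sympI transpI simp: torus_rel_def intro: rcong_sym rcong_trans)

instantiation torus :: ab_group_add
begin

lift_definition zero_torus :: torus is "(0, 0)" .

lift_definition plus_torus :: "torus \<Rightarrow> torus \<Rightarrow> torus" is "\<lambda>p q. p + q"
  by (auto simp: torus_rel_def intro: rcong_add)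

lift_definition uminus_torus :: "torus \<Rightarrow> torus" is "\<lambda>p. - p"
  by (auto simp: torus_rel_def)

lift_definition minus_torus :: "torus \<Rightarrow> torus \<Rightarrow> torus" is "\<lambda>p q. p - q"
  by (auto simp: torus_rel_def intro: rcong_diff)

instance
  by standard (transfer; simp add: torus_rel_def algebra_simps)+

end

instantiation torus :: topological_space
begin

definition open_torus :: "torus set \<Rightarrow> bool" where
  "open_torus U \<longleftrightarrow> open (torus_of -` U)"

instance
  by standard (auto simp: open_torus_def vimage_Union intro!: open_Int)

end

text \<open>Differentiability is expressed through the covering map \<^const>\<open>torus_of\<close>:
  a real function on the torus is $C^1$ iff its doubly periodic lift is.\<close>

definition C1_torus :: "(torus \<Rightarrow> real) \<Rightarrow> bool" where
  "C1_torus \<zeta> \<longleftrightarrow>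
     (\<exists>D :: real \<times> real \<Rightarrow> (real \<times> real) \<Rightarrow>\<^sub>L real.
        (\<forall>z. ((\<lambda>w. \<zeta> (torus_of w)) has_derivative blinfun_apply (D z)) (at z)) \<and>
        continuous_on UNIV D)"

text \<open>The derivative of a self-map of the torus at \<open>p\<close>, with all tangent spaces
  identified with $\mathbb{R}^2$ by means of \<^const>\<open>torus_of\<close>, is the derivative of a
  local lift \<open>g\<close>; it does not depend on the choice of \<open>z\<close> and \<open>g\<close>.\<close>

definition torus_has_derivative ::
    "(torus \<Rightarrow> torus) \<Rightarrow> (real \<times> real \<Rightarrow> real \<times> real) \<Rightarrow> torus \<Rightarrow> bool" where
  "torus_has_derivative f A p \<longleftrightarrow>
     (\<exists>z g. torus_of z = p \<and>
        (\<forall>\<^sub>F w in nhds z. f (torus_of w) = torus_of (g w)) \<and>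
        (g has_derivative A) (at z))"

section \<open>Dynamics\<close>

text \<open>The complex-linear extension of a real-linear map of $\mathbb{R}^2$ to $\mathbb{C}^2$.\<close>

definition complexify ::
    "(real \<times> real \<Rightarrow> real \<times> real) \<Rightarrow> complex \<times> complex \<Rightarrow> complex \<times> complex" where
  "complexify A v =
     (let u = A (Re (fst v), Re (snd v)); w = A (Im (fst v), Im (snd v))
      in (Complex (fst u) (fst w), Complex (snd u) (snd w)))"

definition is_eigenvalue :: "(real \<times> real \<Rightarrow> real \<times> real) \<Rightarrow> complex \<Rightarrow> bool" where
  "is_eigenvalue A \<mu> \<longleftrightarrow>
     (\<exists>v. v \<noteq> 0 \<and> complexify A v = (\<mu> * fst v, \<mu> * snd v))"

definition hyperbolic_fixed_point :: "(torus \<Rightarrow> torus) \<Rightarrow> torus \<Rightarrow> bool" where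
  "hyperbolic_fixed_point f p \<longleftrightarrow>
     f p = p \<and>
     (\<exists>A. torus_has_derivative f A p \<and> (\<forall>\<mu>. is_eigenvalue A \<mu> \<longrightarrow> cmod \<mu> \<noteq> 1))"

definition basin :: "('a::topological_space \<Rightarrow> 'a) \<Rightarrow> 'a \<Rightarrow> 'a set" where
  "basin f p = {z. (\<lambda>n. (f ^^ n) z) \<longlonglongrightarrow> p}"

definition asymptotically_stable :: "('a::topological_space \<Rightarrow> 'a) \<Rightarrow> 'a \<Rightarrow> bool" where
  "asymptotically_stable f p \<longleftrightarrow>
     f p = p \<and>
     (\<forall>U. open U \<and> p \<in> U \<longrightarrow>
        (\<exists>W. open W \<and> p \<in> W \<and> (\<forall>z\<in>W. \<forall>n. (f ^^ n) z \<in> U))) \<and>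
     (\<exists>W. open W \<and> p \<in> W \<and> W \<subseteq> basin f p)"

definition sink :: "(torus \<Rightarrow> torus) \<Rightarrow> torus \<Rightarrow> bool" where
  "sink f p \<longleftrightarrow> hyperbolic_fixed_point f p \<and> asymptotically_stable f p"

definition orbital_derivative :: "('a \<Rightarrow> 'a) \<Rightarrow> ('a \<Rightarrow> real) \<Rightarrow> 'a \<Rightarrow> real" where
  "orbital_derivative f W z = W (f z) - W z"

definition strict_lyapunov ::
    "('a::topological_space \<Rightarrow> 'a) \<Rightarrow> ('a \<Rightarrow> real) \<Rightarrow> 'a set \<Rightarrow> 'a \<Rightarrow> bool" where
  "strict_lyapunov f W D p \<longleftrightarrow>
     open D \<and> f ` D \<subseteq> D \<and> continuous_on D W \<and>
     p \<in> D \<and> f p = p \<and>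
     W p = 0 \<and> (\<forall>z\<in>D - {p}. W z > 0) \<and>
     (\<forall>z\<in>D. orbital_derivative f W z \<le> 0) \<and>
     (\<forall>z\<in>D - {p}. orbital_derivative f W z < 0)"

definition topological_conjugacy ::
    "('a::topological_space \<Rightarrow> 'a) \<Rightarrow> ('b::topological_space \<Rightarrow> 'b) \<Rightarrow> ('a \<Rightarrow> 'b) \<Rightarrow> bool" where
  "topological_conjugacy f g h \<longleftrightarrow>
     (\<exists>k. homeomorphism UNIV UNIV h k) \<and> h \<circ> f = g \<circ> h"

section \<open>Three clocks on a line\<close>

lift_definition clock_map :: "real \<Rightarrow> torus \<Rightarrow> torus" is
  "\<lambda>a (x, y). (x + 2 * a * sin x + a * sin y, y + a * sin x + 2 * a * sin y)"
proof -
  fix a :: real and p q :: "real \<times> real"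
  assume r: "torus_rel p q"
  have "sin (fst p) = sin (fst q)" "sin (snd p) = sin (snd q)"
    using r by (auto simp: torus_rel_def intro: sin_rcong)
  then show "torus_rel
      (case p of (x, y) \<Rightarrow> (x + 2 * a * sin x + a * sin y, y + a * sin x + 2 * a * sin y))
      (case q of (x, y) \<Rightarrow> (x + 2 * a * sin x + a * sin y, y + a * sin x + 2 * a * sin y))"
    using r by (auto simp: torus_rel_def split: prod.splits)
qed

definition perturbed_clock_map ::
    "real \<Rightarrow> (torus \<Rightarrow> real) \<Rightarrow> (torus \<Rightarrow> real) \<Rightarrow> real \<Rightarrow> real \<Rightarrow> torus \<Rightarrow> torus" where
  "perturbed_clock_map a \<zeta>\<^sub>1 \<zeta>\<^sub>2 \<delta>\<^sub>1 \<delta>\<^sub>2 z =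
     clock_map a z + torus_of (\<delta>\<^sub>1 * \<zeta>\<^sub>1 z, \<delta>\<^sub>2 * \<zeta>\<^sub>2 z)"

text \<open>\<open>x rmod (2 * pi)\<close> is the representative of \<open>x\<close> in $[0, 2\pi[$.\<close>

lift_definition clock_lyapunov :: "torus \<Rightarrow> real" is
  "\<lambda>(x, y). \<bar>pi - x rmod (2 * pi)\<bar> + \<bar>pi - y rmod (2 * pi)\<bar>"
  by (auto simp: torus_rel_def rcong_def)

lemma clock_lyapunov_torus_of:
  assumes "x \<in> {0..<2 * pi}" "y \<in> {0..<2 * pi}"
  shows "clock_lyapunov (torus_of (x, y)) = \<bar>pi - x\<bar> + \<bar>pi - y\<bar>"
  using assms by (simp add: clock_lyapunov.abs_eq)

end

theory Submission
  imports Defs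
begin

text \<open>In the coordinates $u = x - \pi$, $v = y - \pi$ the map sends $u$ to
  $u - 2a\sin u - a\sin v$, and symmetrically $v$. Since $2a < 1$, the triangle inequality gives
  $V \circ F \le V - a(|\sin u| + |\sin v|)$, which is a strict decrease away from the four fixed
  points and a geometric contraction near $(\pi,\pi)$. Asymptotic stability and the Lyapunov
  property are topological and are carried over by the conjugacy.

  Hyperbolicity is not a topological property. As \<open>h\<close> need not be close to the identity, the
  position of $h(\pi,\pi)$ is not known; but a fixed point of the perturbed map has $\sin x$ and
  $\sin y$ small, so the derivative there is close to $I + aB$ with
  $B = ((2c, d), (c, 2d))$, $c, d \approx \pm 1$, and this is hyperbolic in all four cases.\<close>

section \<open>Topology of the torus\<close>

lemma open_torus_iff: "open U \<longleftrightarrow> open (torus_of -` U)" for U :: "torus set"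
  by (rule open_torus_def)

lemma continuous_on_torus_of: "continuous_on UNIV torus_of"
  by (auto simp: continuous_on_open_vimage open_torus_iff)

text \<open>The topology is the quotient topology of \<open>torus_of\<close>, so continuity can be
  tested on the lift.\<close>

lemma continuous_on_torusI:
  fixes f :: "torus \<Rightarrow> 'b::topological_space"
  assumes "continuous_on UNIV (\<lambda>w. f (torus_of w))"
  shows "continuous_on UNIV f"
  using assms by (auto simp: continuous_on_open_vimage open_torus_iff vimage_def)

lemma torus_of_eqI:
  assumes "[x = x'] (rmod (2 * pi))" "[y = y'] (rmod (2 * pi))"
  shows "torus_of (x, y) = torus_of (x', y')"
  using assms by (simp add: torus.abs_eq_iff torus_rel_def)

text \<open>The closed square is used because it is compact, which later yields bounds for the
  perturbation and its derivative.\<close>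

lemma torus_cases:
  obtains x y where "0 \<le> x" "x \<le> 2 * pi" "0 \<le> y" "y \<le> 2 * pi" "z = torus_of (x, y)"
proof -
  obtain x y where z: "z = torus_of (x, y)"
    by (metis Quotient_abs_rep Quotient_torus surj_pair)
  have "z = torus_of (x rmod (2 * pi), y rmod (2 * pi))"
    unfolding z by (rule torus_of_eqI) auto
  moreover have "0 \<le> t rmod (2 * pi)" "t rmod (2 * pi) \<le> 2 * pi" for t
    by (auto intro: rmod_nonneg rmod_le)
  ultimately show thesis using that by blast
qed

text \<open>Centred coordinates put the sink at the origin and turn V into the l1 norm on this
  square.\<close>

lemma torus_cases_centered:
  obtains u v where "\<bar>u\<bar> \<le> pi" "\<bar>v\<bar> \<le> pi" "z = torus_of (pi + u, pi + v)"
proof -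
  obtain x y where xy: "0 \<le> x" "x \<le> 2 * pi" "0 \<le> y" "y \<le> 2 * pi" "z = torus_of (x, y)"
    by (rule torus_cases)
  show thesis
    by (rule that[of "x - pi" "y - pi"]) (use xy in auto)
qed

section \<open>Transport along a topological conjugacy\<close>

lemma conjugacy_funpow:
  assumes "h \<circ> f = g \<circ> h"
  shows "(g ^^ n) (h z) = h ((f ^^ n) z)"
  using assms by (induction n) (auto simp: fun_eq_iff)

text \<open>Only open sets and limits of orbits enter. A neighbourhood of \<open>h p\<close> is
  pulled back by \<open>h\<close>, and the neighbourhood found for \<open>f\<close> is carried over
  as a preimage under the inverse \<open>k\<close>, which is open because \<open>k\<close> is
  continuous.\<close>

lemma asymptotically_stable_conjugate:
  assumes "topological_conjugacy f g h" and "asymptotically_stable f p"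
  shows "asymptotically_stable g (h p)"
proof -
  obtain k where hk: "homeomorphism UNIV UNIV h k" and conj: "h \<circ> f = g \<circ> h"
    using assms(1) by (auto simp: topological_conjugacy_def)
  have cont: "continuous_on UNIV h" "continuous_on UNIV k"
    and inv: "\<And>z. k (h z) = z" "\<And>z. h (k z) = z"
    using hk by (auto simp: homeomorphism_def)
  have ovim: "open (h -` U)" if "open U" for U
    using that cont(1) by (simp add: continuous_on_open_vimage)
  have oim: "open (k -` U)" if "open U" for U
    using that cont(2) by (simp add: continuous_on_open_vimage)
  note pow = conjugacy_funpow[OF conj]
  have fp: "f p = p" using assms(2) by (simp add: asymptotically_stable_def)
  show ?thesis
    unfolding asymptotically_stable_def
  proof (intro conjI allI impI)
    show "g (h p) = h p" using conj fp by (metis comp_apply)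
  next
    fix U assume U: "open U \<and> h p \<in> U"
    then obtain W where W: "open W" "p \<in> W" "\<And>z n. z \<in> W \<Longrightarrow> (f ^^ n) z \<in> h -` U"
      using assms(2) ovim[of U] unfolding asymptotically_stable_def
      by (metis vimageI)
    have "(g ^^ n) z \<in> U" if "z \<in> k -` W" for z n
      using W(3)[of "k z" n] that pow[of n "k z"] inv by simp
    then show "\<exists>W. open W \<and> h p \<in> W \<and> (\<forall>z\<in>W. \<forall>n. (g ^^ n) z \<in> U)"
      using W inv oim by (intro exI[of _ "k -` W"]) auto
  next
    obtain W where W: "open W" "p \<in> W" "W \<subseteq> basin f p"
      using assms(2) by (auto simp: asymptotically_stable_def)
    have "z \<in> basin g (h p)" if "z \<in> k -` W" for z
    proof -
      have "(\<lambda>n. (f ^^ n) (k z)) \<longlonglongrightarrow> p" using W that by (auto simp: basin_def)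
      then have "(\<lambda>n. h ((f ^^ n) (k z))) \<longlonglongrightarrow> h p"
        by (rule continuous_on_tendsto_compose[OF cont(1)]) auto
      then show ?thesis using pow[of _ "k z"] inv by (simp add: basin_def)
    qed
    then show "\<exists>W. open W \<and> h p \<in> W \<and> W \<subseteq> basin g (h p)"
      using W inv oim by (intro exI[of _ "k -` W"]) auto
  qed
qed

text \<open>Since \<open>g (h z) = h (f z)\<close>, the transported function and its orbital
  derivative take at \<open>h z\<close> the values that \<open>W\<close> and its orbital derivative
  take at \<open>z\<close>.\<close>

lemma strict_lyapunov_conjugate:
  assumes "topological_conjugacy f g h" and "strict_lyapunov f W D p"
  shows "strict_lyapunov g (W \<circ> inv h) (h ` D) (h p)"
proof -
  obtain k where hk: "homeomorphism UNIV UNIV h k" and conj: "h \<circ> f = g \<circ> h"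
    using assms(1) by (auto simp: topological_conjugacy_def)
  have inv: "\<And>z. k (h z) = z" "\<And>z. h (k z) = z" and contk: "continuous_on UNIV k"
    using hk by (auto simp: homeomorphism_def)
  have [simp]: "inv h = k"
    using inv by (intro inv_unique_comp) auto
  have gh: "g (h z) = h (f z)" for z using conj by (metis comp_apply)
  have "open (h ` D)"
  proof -
    have "h ` D = k -` D" using inv(1) by (auto simp: image_iff) (metis inv(2))
    then show ?thesis
      using assms(2) contk by (simp add: strict_lyapunov_def continuous_on_open_vimage)
  qed
  moreover have "continuous_on (h ` D) (W \<circ> k)"
    using assms(2) inv continuous_on_subset[OF contk]
    by (intro continuous_on_compose) (auto simp: strict_lyapunov_def image_image)
  moreover have "h z = h p \<longleftrightarrow> z = p" for z
    using inv by metis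
  ultimately show ?thesis
    using assms(2) unfolding strict_lyapunov_def orbital_derivative_def
    by (auto simp: gh inv)
qed

section \<open>The unperturbed map\<close>

lemma clock_map_torus_of:
  "clock_map a (torus_of (x, y)) =
     torus_of (x + 2 * a * sin x + a * sin y, y + a * sin x + 2 * a * sin y)"
  by (simp add: clock_map.abs_eq)

lemma continuous_on_clock_map: "continuous_on UNIV (clock_map a)"
proof (rule continuous_on_torusI)
  have "continuous_on UNIV (\<lambda>w::real \<times> real. torus_of
      (fst w + 2 * a * sin (fst w) + a * sin (snd w),
       snd w + a * sin (fst w) + 2 * a * sin (snd w)))"
    by (rule continuous_on_compose2[OF continuous_on_torus_of]) (auto intro!: continuous_intros)
  then show "continuous_on UNIV (\<lambda>w. clock_map a (torus_of w))"
    by (simp add: clock_map.abs_eq case_prod_unfold)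
qed

text \<open>\<^term>\<open>arccos (cos u)\<close> is the distance from \<open>u\<close> to $2\pi\mathbb{Z}$; this form makes the
  continuity of \<^const>\<open>clock_lyapunov\<close> across the edges of the fundamental square evident.\<close>

lemma clock_lyapunov_arccos:
  "clock_lyapunov (torus_of (pi + u, pi + v)) = arccos (cos u) + arccos (cos v)"
proof -
  have "\<bar>pi - (pi + t) rmod (2 * pi)\<bar> = arccos (cos t)" for t
  proof -
    have "0 \<le> (pi + t) rmod (2 * pi)" "(pi + t) rmod (2 * pi) < 2 * pi"
      by (auto intro: rmod_nonneg rmod_less)
    then have "arccos (cos (pi - (pi + t) rmod (2 * pi))) = \<bar>pi - (pi + t) rmod (2 * pi)\<bar>"
      by (intro arccos_cos_eq_abs) auto
    moreover have "cos (pi - (pi + t) rmod (2 * pi)) = cos t"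
      by (simp add: cos_diff)
    ultimately show ?thesis by simp
  qed
  then show ?thesis by (simp add: clock_lyapunov.abs_eq)
qed

lemma clock_lyapunov_centered:
  assumes "\<bar>u\<bar> \<le> pi" "\<bar>v\<bar> \<le> pi"
  shows "clock_lyapunov (torus_of (pi + u, pi + v)) = \<bar>u\<bar> + \<bar>v\<bar>"
  using assms by (simp add: clock_lyapunov_arccos arccos_cos_eq_abs)

text \<open>Beyond distance pi from 0 the bound is trivial, as arccos never exceeds pi.\<close>

lemma arccos_cos_le_abs: "arccos (cos u) \<le> \<bar>u\<bar>"
  using arccos_cos_eq_abs[of u] arccos_ubound[of "cos u"] by (cases "\<bar>u\<bar> \<le> pi") auto

text \<open>Stated for all \<open>u\<close> and \<open>v\<close> because the map may push a point
  out of the centred square.\<close>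

lemma clock_lyapunov_le: "clock_lyapunov (torus_of (pi + u, pi + v)) \<le> \<bar>u\<bar> + \<bar>v\<bar>"
  using arccos_cos_le_abs[of u] arccos_cos_le_abs[of v] by (simp add: clock_lyapunov_arccos)

lemma continuous_on_clock_lyapunov: "continuous_on UNIV clock_lyapunov"
proof (rule continuous_on_torusI)
  have "clock_lyapunov (torus_of w) =
      arccos (cos (fst w - pi)) + arccos (cos (snd w - pi))" for w
    using clock_lyapunov_arccos[of "fst w - pi" "snd w - pi"] by simp
  moreover have "continuous_on UNIV
      (\<lambda>w::real \<times> real. arccos (cos (fst w - pi)) + arccos (cos (snd w - pi)))"
    by (intro continuous_intros) auto
  ultimately show "continuous_on UNIV (\<lambda>w. clock_lyapunov (torus_of w))" by simp
qed

lemma clock_lyapunov_center: "clock_lyapunov (torus_of (pi, pi)) = 0"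
  using clock_lyapunov_centered[of 0 0] by simp

lemma clock_lyapunov_pos:
  assumes "z \<noteq> torus_of (pi, pi)"
  shows "clock_lyapunov z > 0"
proof -
  obtain u v where uv: "\<bar>u\<bar> \<le> pi" "\<bar>v\<bar> \<le> pi" "z = torus_of (pi + u, pi + v)"
    by (rule torus_cases_centered)
  have "u \<noteq> 0 \<or> v \<noteq> 0" using assms uv(3) by auto
  then show ?thesis by (auto simp: uv clock_lyapunov_centered)
qed

lemma clock_lyapunov_nonneg: "clock_lyapunov z \<ge> 0"
  using clock_lyapunov_pos[of z] clock_lyapunov_center by fastforce

lemma clock_map_center: "clock_map a (torus_of (pi, pi)) = torus_of (pi, pi)"
  by (simp add: clock_map_torus_of)

text \<open>The sublevel sets of V form a neighbourhood base at the centre: V is the l1 norm there,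
  which dominates the Euclidean distance.\<close>

lemma clock_lyapunov_sublevel_subset:
  assumes "open U" "torus_of (pi, pi) \<in> U"
  obtains r where "r > 0" "\<And>z. clock_lyapunov z < r \<Longrightarrow> z \<in> U"
proof -
  have "open (torus_of -` U)" "(pi, pi) \<in> torus_of -` U"
    using assms by (auto simp: open_torus_iff)
  then obtain r where r: "r > 0" "ball (pi, pi) r \<subseteq> torus_of -` U"
    by (meson openE)
  show thesis
  proof (rule that[OF r(1)])
    fix z assume z: "clock_lyapunov z < r"
    obtain u v where uv: "\<bar>u\<bar> \<le> pi" "\<bar>v\<bar> \<le> pi" "z = torus_of (pi + u, pi + v)"
      by (rule torus_cases_centered)
    have "dist (pi, pi) (pi + u, pi + v) \<le> \<bar>u\<bar> + \<bar>v\<bar>"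
      using sqrt_sum_squares_le_sum_abs[of u v] by (simp add: dist_Pair_Pair dist_real_def)
    also have "\<dots> < r" using z uv by (simp add: clock_lyapunov_centered)
    finally show "z \<in> U" using r(2) uv(3) by auto
  qed
qed

section \<open>Decrease of the Lyapunov function along orbits\<close>

text \<open>On [-pi, pi] the sine has the sign of its argument, and 2a < 1 keeps the subtraction
  from overshooting zero.\<close>

lemma abs_minus_sin:
  fixes u a :: real
  assumes "\<bar>u\<bar> \<le> pi" "0 < a" "a < 1 / 3"
  shows "\<bar>u - 2 * a * sin u\<bar> = \<bar>u\<bar> - 2 * a * \<bar>sin u\<bar>"
proof -
  have *: "2 * a * \<bar>sin u\<bar> \<le> \<bar>u\<bar>"
    using abs_sin_x_le_abs_x[of u] assms mult_right_mono[of "2 * a" 1 "\<bar>sin u\<bar>"] by simp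
  show ?thesis
  proof (cases "u \<ge> 0")
    case True
    then have "sin u \<ge> 0" using assms by (intro sin_ge_zero) auto
    then show ?thesis using * True by simp
  next
    case False
    then have "sin (- u) \<ge> 0" using assms by (intro sin_ge_zero) auto
    then show ?thesis using * False by simp
  qed
qed

lemma clock_lyapunov_decrease:
  assumes "0 < a" "a < 1 / 3" "\<bar>u\<bar> \<le> pi" "\<bar>v\<bar> \<le> pi"
  shows "clock_lyapunov (clock_map a (torus_of (pi + u, pi + v)))
    \<le> \<bar>u\<bar> + \<bar>v\<bar> - a * (\<bar>sin u\<bar> + \<bar>sin v\<bar>)"
proof -
  have "clock_map a (torus_of (pi + u, pi + v)) =
      torus_of (pi + (u - 2 * a * sin u - a * sin v), pi + (v - a * sin u - 2 * a * sin v))"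
    by (simp add: clock_map_torus_of algebra_simps)
  then have "clock_lyapunov (clock_map a (torus_of (pi + u, pi + v)))
      \<le> \<bar>u - 2 * a * sin u - a * sin v\<bar> + \<bar>v - a * sin u - 2 * a * sin v\<bar>"
    using clock_lyapunov_le by metis
  \<comment> \<open>The diagonal terms will gain 2a(|sin u| + |sin v|), while the coupling terms
    split off here cost at most half of that.\<close>
  also have "\<dots> \<le> (\<bar>u - 2 * a * sin u\<bar> + \<bar>a * sin v\<bar>) + (\<bar>v - 2 * a * sin v\<bar> + \<bar>a * sin u\<bar>)"
    by linarith
  also have "\<dots> = \<bar>u\<bar> + \<bar>v\<bar> - a * (\<bar>sin u\<bar> + \<bar>sin v\<bar>)"
    unfolding abs_minus_sin[OF assms(3,1,2)] abs_minus_sin[OF assms(4,1,2)]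
    using assms by (simp add: abs_mult algebra_simps)
  finally show ?thesis .
qed

text \<open>If both sines vanish the point is fixed, so at any other point the decrement is
  positive.\<close>

lemma clock_lyapunov_strict_decrease:
  assumes a: "0 < a" "a < 1 / 3" and "clock_map a z \<noteq> z"
  shows "clock_lyapunov (clock_map a z) < clock_lyapunov z"
proof -
  obtain u v where uv: "\<bar>u\<bar> \<le> pi" "\<bar>v\<bar> \<le> pi" "z = torus_of (pi + u, pi + v)"
    by (rule torus_cases_centered)
  have "sin u \<noteq> 0 \<or> sin v \<noteq> 0"
    using assms(3) by (auto simp: uv(3) clock_map_torus_of)
  then have "0 < a * (\<bar>sin u\<bar> + \<bar>sin v\<bar>)"
    using a by (intro mult_pos_pos) auto
  then show ?thesis
    using clock_lyapunov_decrease[OF a uv(1,2)] uv by (simp add: clock_lyapunov_centered)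
qed

lemma clock_lyapunov_contraction:
  assumes a: "0 < a" "a < 1 / 3" and z: "clock_lyapunov z < 1"
  shows "clock_lyapunov (clock_map a z) \<le> (1 - a / 2) * clock_lyapunov z"
proof -
  obtain u v where uv: "\<bar>u\<bar> \<le> pi" "\<bar>v\<bar> \<le> pi" "z = torus_of (pi + u, pi + v)"
    by (rule torus_cases_centered)
  \<comment> \<open>By the mean value theorem, with slope cos s >= cos(pi/3) = 1/2 because s < 1 <
    pi/3. This turns the decrement a(|sin u| + |sin v|) into at least (a/2) V.\<close>
  have half: "\<bar>t\<bar> / 2 \<le> \<bar>sin t\<bar>" if "\<bar>t\<bar> < 1" for t :: real
  proof -
    have "\<bar>t\<bar> / 2 \<le> sin \<bar>t\<bar>"
    proof (cases "t = 0")
      case False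
      then obtain s where s: "0 < s" "s < \<bar>t\<bar>" "sin \<bar>t\<bar> - sin 0 = (\<bar>t\<bar> - 0) * cos s"
        using MVT2[of 0 "\<bar>t\<bar>" sin cos] by auto
      have "cos (pi / 3) \<le> cos s"
        using s that pi_gt3 by (intro cos_monotone_0_pi_le) auto
      then have "\<bar>t\<bar> * (1 / 2) \<le> \<bar>t\<bar> * cos s"
        by (intro mult_left_mono) (auto simp: cos_60)
      then show ?thesis using s by simp
    qed auto
    then show ?thesis by (auto simp: abs_if split: if_splits)
  qed
  have V: "clock_lyapunov z = \<bar>u\<bar> + \<bar>v\<bar>"
    using uv by (simp add: clock_lyapunov_centered)
  have "\<bar>u\<bar> < 1" "\<bar>v\<bar> < 1" using z V by linarith+
  then have "a * ((\<bar>u\<bar> + \<bar>v\<bar>) / 2) \<le> a * (\<bar>sin u\<bar> + \<bar>sin v\<bar>)"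
    using half[of u] half[of v] a by (intro mult_left_mono) auto
  then show ?thesis
    using clock_lyapunov_decrease[OF a uv(1,2)] unfolding V uv(3)[symmetric]
    by (simp add: left_diff_distrib)
qed

section \<open>Basin of attraction and asymptotic stability\<close>

lemma clock_lyapunov_iterate_le:
  assumes a: "0 < a" "a < 1 / 3" and z: "clock_lyapunov z < 1"
  shows "clock_lyapunov ((clock_map a ^^ n) z) \<le> (1 - a / 2) ^ n * clock_lyapunov z"
proof (induction n)
  case (Suc n)
  \<comment> \<open>The iterate stays in the sublevel set V < 1, so the contraction can be applied
    once more.\<close>
  have "(1 - a / 2) ^ n * clock_lyapunov z \<le> 1 * clock_lyapunov z"
    using a clock_lyapunov_nonneg by (intro mult_right_mono power_le_one) auto
  then have "clock_lyapunov ((clock_map a ^^ n) z) < 1" using Suc z by simp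
  from clock_lyapunov_contraction[OF a this]
  have "clock_lyapunov ((clock_map a ^^ Suc n) z)
      \<le> (1 - a / 2) * clock_lyapunov ((clock_map a ^^ n) z)"
    by simp
  also have "\<dots> \<le> (1 - a / 2) * ((1 - a / 2) ^ n * clock_lyapunov z)"
    using Suc a by (intro mult_left_mono) auto
  finally show ?case by (simp add: mult.assoc)
qed auto

lemma clock_lyapunov_sublevel_basin:
  assumes a: "0 < a" "a < 1 / 3" and z: "clock_lyapunov z < 1"
  shows "z \<in> basin (clock_map a) (torus_of (pi, pi))"
  unfolding basin_def mem_Collect_eq
proof (rule topological_tendstoI)
  fix U :: "torus set" assume "open U" "torus_of (pi, pi) \<in> U"
  then obtain r where r: "r > 0" "\<And>z. clock_lyapunov z < r \<Longrightarrow> z \<in> U"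
    using clock_lyapunov_sublevel_subset by blast
  have "(\<lambda>n. (1 - a / 2) ^ n * clock_lyapunov z) \<longlonglongrightarrow> 0"
    using a by (intro tendsto_mult_left_zero LIMSEQ_realpow_zero) auto
  then have "\<forall>\<^sub>F n in sequentially. (1 - a / 2) ^ n * clock_lyapunov z < r"
    using r(1) by (rule order_tendstoD)
  then show "\<forall>\<^sub>F n in sequentially. (clock_map a ^^ n) z \<in> U"
    by eventually_elim (blast intro: r(2) le_less_trans[OF clock_lyapunov_iterate_le[OF a z]])
qed

lemma open_clock_lyapunov_sublevel: "open {z. clock_lyapunov z < r}"
  using continuous_on_clock_lyapunov by (intro open_Collect_less) auto

lemma asymptotically_stable_clock_map:
  assumes a: "0 < a" "a < 1 / 3"
  shows "asymptotically_stable (clock_map a) (torus_of (pi, pi))"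
  unfolding asymptotically_stable_def
proof (intro conjI allI impI)
  fix U :: "torus set" assume "open U \<and> torus_of (pi, pi) \<in> U"
  then obtain r where r: "r > 0" "\<And>z. clock_lyapunov z < r \<Longrightarrow> z \<in> U"
    using clock_lyapunov_sublevel_subset by blast
  \<comment> \<open>The bound 1 makes the contraction available, the bound \<open>r\<close> keeps
    the orbit in \<open>U\<close>.\<close>
  have "(clock_map a ^^ n) z \<in> U" if z: "clock_lyapunov z < min r 1" for z n
  proof -
    have "(1 - a / 2) ^ n * clock_lyapunov z \<le> 1 * clock_lyapunov z"
      using a clock_lyapunov_nonneg by (intro mult_right_mono power_le_one) auto
    then show ?thesis
      using clock_lyapunov_iterate_le[OF a, of z n] z by (intro r(2)) simp
  qed
  then show "\<exists>W. open W \<and> torus_of (pi, pi) \<in> W \<and> (\<forall>z\<in>W. \<forall>n. (clock_map a ^^ n) z \<in> U)"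
    using r(1) open_clock_lyapunov_sublevel[of "min r 1"]
    by (intro exI[of _ "{z. clock_lyapunov z < min r 1}"])
      (auto simp: clock_lyapunov_center simp del: min_less_iff_conj)
next
  show "\<exists>W. open W \<and> torus_of (pi, pi) \<in> W \<and> W \<subseteq> basin (clock_map a) (torus_of (pi, pi))"
    using clock_lyapunov_sublevel_basin[OF a] open_clock_lyapunov_sublevel[of 1]
    by (intro exI[of _ "{z. clock_lyapunov z < 1}"]) (auto simp: clock_lyapunov_center)
qed (rule clock_map_center)

text \<open>Convergence forces entry into the open set V < 1, and entry forces convergence of the
  shifted orbit, hence of the orbit. This description exhibits the basin as a union of open
  preimages.\<close>

lemma basin_clock_map_iff:
  assumes a: "0 < a" "a < 1 / 3"
  shows "z \<in> basin (clock_map a) (torus_of (pi, pi))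
    \<longleftrightarrow> (\<exists>n. clock_lyapunov ((clock_map a ^^ n) z) < 1)"
proof
  assume "z \<in> basin (clock_map a) (torus_of (pi, pi))"
  then have "(\<lambda>n. (clock_map a ^^ n) z) \<longlonglongrightarrow> torus_of (pi, pi)" by (simp add: basin_def)
  from topological_tendstoD[OF this open_clock_lyapunov_sublevel[of 1]]
  show "\<exists>n. clock_lyapunov ((clock_map a ^^ n) z) < 1"
    by (auto simp: clock_lyapunov_center eventually_sequentially)
next
  assume "\<exists>n. clock_lyapunov ((clock_map a ^^ n) z) < 1"
  then obtain n where "(clock_map a ^^ n) z \<in> basin (clock_map a) (torus_of (pi, pi))"
    using clock_lyapunov_sublevel_basin[OF a] by blast
  then have "(\<lambda>m. (clock_map a ^^ (m + n)) z) \<longlonglongrightarrow> torus_of (pi, pi)"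
    by (simp add: basin_def funpow_add)
  then show "z \<in> basin (clock_map a) (torus_of (pi, pi))"
    unfolding basin_def mem_Collect_eq by (rule LIMSEQ_offset)
qed

text \<open>A constant orbit converging to the centre would eventually have V below its own positive
  value. V thus separates the points, in place of a Hausdorff argument.\<close>

lemma fixed_point_in_clock_basin:
  assumes "clock_map a z = z" "z \<in> basin (clock_map a) (torus_of (pi, pi))"
  shows "z = torus_of (pi, pi)"
proof (rule ccontr)
  assume "z \<noteq> torus_of (pi, pi)"
  then have pos: "clock_lyapunov z > 0" by (rule clock_lyapunov_pos)
  have "(clock_map a ^^ n) z = z" for n
    using assms(1) by (induction n) auto
  then have "(\<lambda>n::nat. z) \<longlonglongrightarrow> torus_of (pi, pi)"
    using assms(2) by (simp add: basin_def)
  from topological_tendstoD[OF this open_clock_lyapunov_sublevel[of "clock_lyapunov z"]]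
  show False using pos by (simp add: clock_lyapunov_center)
qed

lemma strict_lyapunov_clock_map:
  assumes a: "0 < a" "a < 1 / 3"
  shows "strict_lyapunov (clock_map a) clock_lyapunov
    (basin (clock_map a) (torus_of (pi, pi))) (torus_of (pi, pi))"
proof -
  let ?B = "basin (clock_map a) (torus_of (pi, pi))"
  have "continuous_on UNIV (clock_map a ^^ n)" for n
  proof (induction n)
    case (Suc n)
    then show ?case
      using continuous_on_compose[OF Suc continuous_on_subset[OF continuous_on_clock_map]] by simp
  qed (simp add: id_def)
  then have "open ((clock_map a ^^ n) -` {z. clock_lyapunov z < 1})" for n
    using open_clock_lyapunov_sublevel[of 1]
    unfolding continuous_on_open_vimage[OF open_UNIV] by (metis inf_top.right_neutral)
  then have "open (\<Union>n. (clock_map a ^^ n) -` {z. clock_lyapunov z < 1})" by blast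
  also have "(\<Union>n. (clock_map a ^^ n) -` {z. clock_lyapunov z < 1}) = ?B"
    using basin_clock_map_iff[OF a] by auto
  finally have "open ?B" .
  moreover have "clock_map a ` ?B \<subseteq> ?B"
  proof
    fix w assume "w \<in> clock_map a ` ?B"
    then obtain z where z: "w = clock_map a z" "(\<lambda>n. (clock_map a ^^ n) z) \<longlonglongrightarrow> torus_of (pi, pi)"
      by (auto simp: basin_def)
    then show "w \<in> ?B"
      using LIMSEQ_Suc[OF z(2)] by (simp add: basin_def funpow_swap1)
  qed
  moreover have "torus_of (pi, pi) \<in> ?B"
    by (rule clock_lyapunov_sublevel_basin[OF a]) (simp add: clock_lyapunov_center)
  \<comment> \<open>V stands still at the other fixed points of the map, but none of them lies in
    the basin.\<close>
  moreover have dec: "orbital_derivative (clock_map a) clock_lyapunov z < 0"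
    if "z \<in> ?B - {torus_of (pi, pi)}" for z
    using clock_lyapunov_strict_decrease[OF a, of z] fixed_point_in_clock_basin[of a z] that
    by (auto simp: orbital_derivative_def)
  moreover have "orbital_derivative (clock_map a) clock_lyapunov z \<le> 0" if "z \<in> ?B" for z
    using dec[of z] that
    by (cases "z = torus_of (pi, pi)") (auto simp: orbital_derivative_def clock_map_center)
  ultimately show ?thesis
    using continuous_on_subset[OF continuous_on_clock_lyapunov]
    by (auto simp: strict_lyapunov_def clock_lyapunov_center clock_map_center
        intro: clock_lyapunov_pos)
qed

section \<open>Hyperbolicity of the fixed points of the perturbed map\<close>

lemma is_eigenvalue_det:
  fixes m11 m12 m21 m22 :: real and \<mu> :: complex
  assumes "is_eigenvalue (\<lambda>(s, t). (m11 * s + m12 * t, m21 * s + m22 * t)) \<mu>"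
  shows "(m11 - \<mu>) * (m22 - \<mu>) = m12 * m21"
proof -
  obtain v1 v2 :: complex where v: "(v1, v2) \<noteq> 0"
    and *: "complexify (\<lambda>(s, t). (m11 * s + m12 * t, m21 * s + m22 * t)) (v1, v2)
      = (\<mu> * v1, \<mu> * v2)"
    using assms by (auto simp: is_eigenvalue_def)
  have "complexify (\<lambda>(s, t). (m11 * s + m12 * t, m21 * s + m22 * t)) (v1, v2)
      = (m11 * v1 + m12 * v2, m21 * v1 + m22 * v2)"
    by (simp add: complexify_def complex_eq_iff)
  with * have 1: "(m11 - \<mu>) * v1 = - (m12 * v2)" and 2: "(m22 - \<mu>) * v2 = - (m21 * v1)"
    by (simp_all add: algebra_simps eq_neg_iff_add_eq_0)
  \<comment> \<open>Cramer's rule: the determinant annihilates both coordinates of the eigenvector,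
    one of which is non-zero.\<close>
  have "((m11 - \<mu>) * (m22 - \<mu>) - m12 * m21) * v1 = 0"
    and "((m11 - \<mu>) * (m22 - \<mu>) - m12 * m21) * v2 = 0"
    using 1 2 unfolding of_real_mult by algebra+
  then show ?thesis using v by (auto simp: zero_prod_def)
qed

text \<open>For $\beta = \mu - 1$, with \<open>T\<close> and \<open>d\<close> the trace and determinant of the derivative minus the
  identity: a nonnegative discriminant makes $\mu$ real, and the other two conditions exclude
  $\mu = 1$ and $\mu = -1$.\<close>

lemma real_quadratic_no_unit_root:
  fixes T d :: real and \<beta> :: complex
  assumes "\<beta>\<^sup>2 - T * \<beta> + d = 0" and "T\<^sup>2 - 4 * d \<ge> 0" and "d \<noteq> 0" and "4 + 2 * T + d \<noteq> 0"
  shows "cmod (1 + \<beta>) \<noteq> 1"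
proof
  assume unit: "cmod (1 + \<beta>) = 1"
  define s where "s = sqrt (T\<^sup>2 - 4 * d)"
  have "s\<^sup>2 = T\<^sup>2 - 4 * d" using assms(2) by (simp add: s_def)
  then have "(complex_of_real s)\<^sup>2 = complex_of_real (T\<^sup>2 - 4 * d)"
    by (metis of_real_power)
  \<comment> \<open>Completing the square.\<close>
  then have "(2 * \<beta> - T)\<^sup>2 = (complex_of_real s)\<^sup>2"
    using assms(1) by (simp, algebra)
  then have "2 * \<beta> - T = s \<or> 2 * \<beta> - T = - s" by (simp add: power2_eq_iff)
  then have "\<beta> = complex_of_real ((T + s) / 2) \<or> \<beta> = complex_of_real ((T - s) / 2)"
    by (auto simp: field_simps)
  then obtain b where b: "\<beta> = complex_of_real b" by blast
  have "complex_of_real (b\<^sup>2 - T * b + d) = 0" using assms(1) b by simp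
  then have q: "b\<^sup>2 - T * b + d = 0" by (simp only: of_real_eq_0_iff)
  have "cmod (1 + \<beta>) = \<bar>1 + b\<bar>" using b by (metis norm_of_real of_real_1 of_real_add)
  then have "b = 0 \<or> b = -2" using unit by auto
  then show False using q assms by auto
qed

lemma abs_mult_le:
  fixes x y :: real
  assumes "\<bar>x\<bar> \<le> X" "\<bar>y\<bar> \<le> Y"
  shows "\<bar>x * y\<bar> \<le> X * Y"
  using assms by (simp add: abs_mult mult_mono')

text \<open>Here \<open>c\<close> and \<open>d\<close> stand for cos x and cos y at the fixed point,
  and the \<open>e\<close>s for the partial derivatives of the perturbation. The tolerance is of
  order a^2 because the determinant of the derivative minus the identity is close to 3 a^2 c d.
  Bounding only the squares of \<open>c\<close> and \<open>d\<close> from below treats all four sign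
  patterns at once.\<close>

lemma perturbed_clock_matrix_hyperbolic:
  fixes a c d e11 e12 e21 e22 :: real and \<mu> :: complex
  assumes a: "0 < a" "a < 1 / 3"
    and c: "\<bar>c\<bar> \<le> 1" "c\<^sup>2 \<ge> 3 / 4" and d: "\<bar>d\<bar> \<le> 1" "d\<^sup>2 \<ge> 3 / 4"
    and e: "\<bar>e11\<bar> \<le> a\<^sup>2 / 100" "\<bar>e12\<bar> \<le> a\<^sup>2 / 100" "\<bar>e21\<bar> \<le> a\<^sup>2 / 100" "\<bar>e22\<bar> \<le> a\<^sup>2 / 100"
    and ev: "is_eigenvalue (\<lambda>(s, t). ((1 + 2 * a * c + e11) * s + (a * d + e12) * t,
        (a * c + e21) * s + (1 + 2 * a * d + e22) * t)) \<mu>"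
  shows "cmod \<mu> \<noteq> 1"
proof -
  define \<eta> where "\<eta> = a\<^sup>2 / 100"
  define T where "T = (2 * a * c + e11) + (2 * a * d + e22)"
  define \<Delta> where "\<Delta> = (2 * a * c + e11) * (2 * a * d + e22) - (a * d + e12) * (a * c + e21)"
  have a2: "a\<^sup>2 < 1 / 9" "a\<^sup>2 > 0"
    using a power_strict_mono[of a "1 / 3" 2] by (auto simp: power2_eq_square)
  have \<eta>: "0 < \<eta>" "\<eta> < 1" using a2 by (auto simp: \<eta>_def)
  have ee: "\<bar>x * y\<bar> \<le> \<eta>" if "\<bar>x\<bar> \<le> 1" "\<bar>y\<bar> \<le> \<eta>" for x y :: real
    using abs_mult_le[OF that] by simp
  have ac: "\<bar>a * c\<bar> \<le> 1 / 3" "\<bar>a * d\<bar> \<le> 1 / 3"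
    using abs_mult_le[of a "1/3" c 1] abs_mult_le[of a "1/3" d 1] a c d by auto
  have e': "\<bar>e11\<bar> \<le> \<eta>" "\<bar>e12\<bar> \<le> \<eta>" "\<bar>e21\<bar> \<le> \<eta>" "\<bar>e22\<bar> \<le> \<eta>"
    using e by (auto simp: \<eta>_def)
  have \<Delta>_eq: "\<Delta> - 3 * a\<^sup>2 * (c * d) =
      2 * ((a * c) * e22) + 2 * ((a * d) * e11) + e11 * e22
      - (a * d) * e21 - (a * c) * e12 - e12 * e21"
    by (simp add: \<Delta>_def algebra_simps power2_eq_square)
  have "\<bar>(a * c) * e22\<bar> \<le> \<eta>" "\<bar>(a * d) * e11\<bar> \<le> \<eta>" "\<bar>e11 * e22\<bar> \<le> \<eta>"
    "\<bar>(a * d) * e21\<bar> \<le> \<eta>" "\<bar>(a * c) * e12\<bar> \<le> \<eta>" "\<bar>e12 * e21\<bar> \<le> \<eta>"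
    using e' ac \<eta> by (auto intro!: ee)
  \<comment> \<open>The weights of the six error products add up to 2 + 2 + 1 + 1 + 1 + 1 =
    8.\<close>
  then have \<Delta>_near: "\<bar>\<Delta> - 3 * a\<^sup>2 * (c * d)\<bar> \<le> 8 * \<eta>"
    unfolding \<Delta>_eq by linarith
  have cd: "\<bar>c * d\<bar> \<ge> 3 / 4"
  proof -
    have "(3 / 4) * (3 / 4) \<le> c\<^sup>2 * d\<^sup>2" using c d by (intro mult_mono) auto
    then have "(3 / 4)\<^sup>2 \<le> \<bar>c * d\<bar>\<^sup>2" by (simp add: power2_eq_square algebra_simps)
    then show ?thesis by (rule power2_le_imp_le) simp
  qed
  have cd1: "\<bar>c * d\<bar> \<le> 1" using abs_mult_le[of c 1 d 1] c d by simp
  have main_det: "\<bar>3 * a\<^sup>2 * (c * d)\<bar> \<ge> 9 / 4 * a\<^sup>2" "\<bar>3 * a\<^sup>2 * (c * d)\<bar> \<le> 1 / 3"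
    using mult_left_mono[OF cd, of "3 * a\<^sup>2"] a2 abs_mult_le[of "3 * a\<^sup>2" "1/3" "c * d" 1] cd1
    by (auto simp: abs_mult)
  \<comment> \<open>The leading term is at least 2.25 a^2 in size, the error at most 0.08
    a^2.\<close>
  have "\<Delta> \<noteq> 0"
    using \<Delta>_near main_det a2 unfolding \<eta>_def by linarith
  moreover have "4 + 2 * T + \<Delta> \<noteq> 0"
  proof -
    \<comment> \<open>The sum is at least 4 - 8/3 - 1/3 - 12 \<eta> = 1 - 12 \<eta>, which is
      positive.\<close>
    have "\<bar>T\<bar> \<le> 4 / 3 + 2 * \<eta>" using ac e' unfolding T_def by linarith
    moreover have "12 * \<eta> < 1" using a2 by (simp add: \<eta>_def)
    ultimately show ?thesis using \<Delta>_near main_det by linarith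
  qed
  moreover have "T\<^sup>2 - 4 * \<Delta> \<ge> 0"
  proof -
    define T0 where "T0 = 2 * (a * c) + 2 * (a * d)"
    have T0: "\<bar>T0\<bar> \<le> 2" "T = T0 + (e11 + e22)"
      using ac by (auto simp: T0_def T_def algebra_simps)
    have "\<bar>T0 * (e11 + e22)\<bar> \<le> 2 * (2 * \<eta>)"
      using T0 e' by (intro abs_mult_le) auto
    then have "T\<^sup>2 \<ge> T0\<^sup>2 - 8 * \<eta>"
      unfolding T0(2) power2_sum[of T0] using zero_le_power2[of "e11 + e22"] by linarith
    \<comment> \<open>The unperturbed discriminant, written as a sum of squares, is at least 3 a^2
      whatever the signs of \<open>c\<close> and \<open>d\<close>.\<close>
    moreover have "T0\<^sup>2 - 4 * (3 * a\<^sup>2 * (c * d)) = a\<^sup>2 * (2 * (c\<^sup>2 + d\<^sup>2) + 2 * (c - d)\<^sup>2)"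
      by (simp add: T0_def power2_eq_square algebra_simps)
    moreover have "a\<^sup>2 * 3 \<le> a\<^sup>2 * (2 * (c\<^sup>2 + d\<^sup>2) + 2 * (c - d)\<^sup>2)"
    proof (rule mult_left_mono)
      show "3 \<le> 2 * (c\<^sup>2 + d\<^sup>2) + 2 * (c - d)\<^sup>2"
        using c(2) d(2) zero_le_power2[of "c - d"] unfolding distrib_left by linarith
    qed simp
    \<comment> \<open>The total error is 8 \<eta> from the squared trace and 4 * 8 \<eta> from the
      determinant.\<close>
    moreover have "40 * \<eta> \<le> a\<^sup>2 * 3" using a2 by (simp add: \<eta>_def)
    ultimately show ?thesis using \<Delta>_near by linarith
  qed
  \<comment> \<open>The characteristic equation, rewritten for the derivative minus the
    identity.\<close>
  moreover have "(\<mu> - 1)\<^sup>2 - T * (\<mu> - 1) + \<Delta> = 0"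
    using is_eigenvalue_det[OF ev] unfolding T_def \<Delta>_def of_real_add of_real_mult of_real_diff of_real_1
      of_real_numeral by algebra
  ultimately show ?thesis
    using real_quadratic_no_unit_root[of "\<mu> - 1" T \<Delta>] by simp
qed

section \<open>Uniform smallness of the perturbation at fixed points\<close>

text \<open>The closed square is compact and contains a representative of every point of the torus,
  so bounds on it serve the whole torus.\<close>

lemma C1_torus_bounds:
  assumes "C1_torus \<zeta>"
  shows "\<exists>M (D :: real \<times> real \<Rightarrow> (real \<times> real) \<Rightarrow>\<^sub>L real).
    (\<forall>z. ((\<lambda>w. \<zeta> (torus_of w)) has_derivative blinfun_apply (D z)) (at z)) \<and>
    (\<forall>w\<in>{0..2 * pi} \<times> {0..2 * pi}. \<bar>\<zeta> (torus_of w)\<bar> \<le> M \<and> norm (D w) \<le> M)"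
proof -
  obtain D :: "real \<times> real \<Rightarrow> (real \<times> real) \<Rightarrow>\<^sub>L real" where
    D: "\<And>z. ((\<lambda>w. \<zeta> (torus_of w)) has_derivative blinfun_apply (D z)) (at z)"
      "continuous_on UNIV D"
    using assms by (auto simp: C1_torus_def)
  let ?K = "{0..2 * pi} \<times> {0..2 * pi}"
  have K: "compact ?K" by (intro compact_Times compact_Icc)
  have "continuous_on UNIV (\<lambda>w. \<zeta> (torus_of w))"
    using D(1) by (meson has_derivative_continuous continuous_at_imp_continuous_on)
  then have "compact ((\<lambda>w. \<zeta> (torus_of w)) ` ?K)" "compact (D ` ?K)"
    using D(2) K by (auto intro!: compact_continuous_image intro: continuous_on_subset)
  then have "bounded ((\<lambda>w. \<zeta> (torus_of w)) ` ?K)" "bounded (D ` ?K)"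
    by (auto intro: compact_imp_bounded)
  then obtain M1 M2 where
    M: "\<And>w. w \<in> ?K \<Longrightarrow> \<bar>\<zeta> (torus_of w)\<bar> \<le> M1" "\<And>w. w \<in> ?K \<Longrightarrow> norm (D w) \<le> M2"
    unfolding bounded_iff ball_simps real_norm_def by blast
  then show ?thesis
    using D(1) by (intro exI[of _ "max M1 M2"] exI[of _ D]) (simp add: le_max_iff_disj)
qed

lemma hyperbolic_fixed_point_perturbed:
  assumes a: "0 < a" "a < 1 / 3"
    and D1: "\<And>z. ((\<lambda>w. \<zeta>\<^sub>1 (torus_of w)) has_derivative blinfun_apply (D1 z)) (at z)"
    and D2: "\<And>z. ((\<lambda>w. \<zeta>\<^sub>2 (torus_of w)) has_derivative blinfun_apply (D2 z)) (at z)"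
    and fp: "perturbed_clock_map a \<zeta>\<^sub>1 \<zeta>\<^sub>2 \<delta>\<^sub>1 \<delta>\<^sub>2 (torus_of (x, y)) = torus_of (x, y)"
    and small: "\<bar>\<delta>\<^sub>1 * \<zeta>\<^sub>1 (torus_of (x, y))\<bar> \<le> a\<^sup>2 / 100" "\<bar>\<delta>\<^sub>2 * \<zeta>\<^sub>2 (torus_of (x, y))\<bar> \<le> a\<^sup>2 / 100"
    and smallD: "\<bar>\<delta>\<^sub>1\<bar> * norm (D1 (x, y)) \<le> a\<^sup>2 / 100" "\<bar>\<delta>\<^sub>2\<bar> * norm (D2 (x, y)) \<le> a\<^sup>2 / 100"
  shows "hyperbolic_fixed_point (perturbed_clock_map a \<zeta>\<^sub>1 \<zeta>\<^sub>2 \<delta>\<^sub>1 \<delta>\<^sub>2) (torus_of (x, y))"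
proof -
  \<comment> \<open>A global lift, which serves as the local lift in
    \<open>torus_has_derivative\<close>.\<close>
  define g where "g = (\<lambda>w. (fst w + 2 * a * sin (fst w) + a * sin (snd w) + \<delta>\<^sub>1 * \<zeta>\<^sub>1 (torus_of w),
      snd w + a * sin (fst w) + 2 * a * sin (snd w) + \<delta>\<^sub>2 * \<zeta>\<^sub>2 (torus_of w)))"
  have g: "perturbed_clock_map a \<zeta>\<^sub>1 \<zeta>\<^sub>2 \<delta>\<^sub>1 \<delta>\<^sub>2 (torus_of w) = torus_of (g w)" for w
    using clock_map_torus_of[of a "fst w" "snd w"]
    by (simp add: perturbed_clock_map_def g_def plus_torus.abs_eq)
  define p1 where "p1 = \<delta>\<^sub>1 * \<zeta>\<^sub>1 (torus_of (x, y))"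
  define p2 where "p2 = \<delta>\<^sub>2 * \<zeta>\<^sub>2 (torus_of (x, y))"
  have a2: "a\<^sup>2 \<le> a * (1 / 3)" unfolding power2_eq_square using a by (intro mult_left_mono) auto
  have p: "\<bar>p1\<bar> \<le> a / 300" "\<bar>p2\<bar> \<le> a / 300" using small a2 by (auto simp: p1_def p2_def)
  have as: "\<bar>a * sin t\<bar> \<le> 1 / 3" for t :: real
    using abs_mult_le[of a "1 / 3" "sin t" 1] a by simp
  have rel: "torus_rel (g (x, y)) (x, y)"
    using fp g[of "(x, y)"] by (simp add: torus.abs_eq_iff)
  \<comment> \<open>The displacement is below 2 pi, so the congruence expressing that the point is
    fixed becomes an exact equation for its lift.\<close>
  have bound: "\<bar>2 * a * sin x + a * sin y + p1\<bar> < 2 * pi"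
    "\<bar>a * sin x + 2 * a * sin y + p2\<bar> < 2 * pi"
    using as[of x] as[of y] p a pi_gt3 by linarith+
  have "[x + 2 * a * sin x + a * sin y + p1 = x] (rmod 2 * pi)"
    "[y + a * sin x + 2 * a * sin y + p2 = y] (rmod 2 * pi)"
    using rel by (simp_all add: torus_rel_def g_def p1_def p2_def)
  then have "x + 2 * a * sin x + a * sin y + p1 = x" "y + a * sin x + 2 * a * sin y + p2 = y"
    using rcong_imp_eq[of "x + 2 * a * sin x + a * sin y + p1" x "2 * pi"]
      rcong_imp_eq[of "y + a * sin x + 2 * a * sin y + p2" y "2 * pi"] bound by linarith+
  then have eqs: "2 * (a * sin x) + a * sin y + p1 = 0" "a * sin x + 2 * (a * sin y) + p2 = 0"
    by simp_all
  \<comment> \<open>Eliminating one unknown gives 3 a sin x = p2 - 2 p1, and likewise for y. The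
    crude bound 1/2 on the sines already yields squared cosines of at least 3/4.\<close>
  have "\<bar>a * sin x\<bar> \<le> a * (1 / 2)" "\<bar>a * sin y\<bar> \<le> a * (1 / 2)"
    using eqs p a by linarith+
  then have "\<bar>sin x\<bar> \<le> 1 / 2" "\<bar>sin y\<bar> \<le> 1 / 2"
    using a by (simp_all add: abs_mult mult_le_cancel_left_pos del: mult_1_right)
  then have sq: "(sin x)\<^sup>2 \<le> (1 / 2)\<^sup>2" "(sin y)\<^sup>2 \<le> (1 / 2)\<^sup>2"
    by (metis abs_ge_zero power2_abs power_mono)+
  have cos: "(cos x)\<^sup>2 \<ge> 3 / 4" "(cos y)\<^sup>2 \<ge> 3 / 4"
    using sq by (simp_all add: cos_squared_eq power_divide)

  define b where "b = (\<lambda>w. blinfun_apply (D1 (x, y)) w)"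
  define c where "c = (\<lambda>w. blinfun_apply (D2 (x, y)) w)"
  \<comment> \<open>Decomposition into partial derivatives, to bring the derivative of
    \<open>g\<close> into matrix form.\<close>
  have split: "blinfun_apply L w = fst w * blinfun_apply L (1, 0) + snd w * blinfun_apply L (0, 1)"
    for L :: "(real \<times> real) \<Rightarrow>\<^sub>L real" and w
  proof -
    have "w = fst w *\<^sub>R (1, 0) + snd w *\<^sub>R (0, 1)" by (simp add: prod_eq_iff)
    then show ?thesis
      by (metis blinfun.add_right blinfun.scaleR_right real_scaleR_def)
  qed
  have Db: "((\<lambda>w. \<zeta>\<^sub>1 (torus_of w)) has_derivative
      (\<lambda>w. fst w * b (1, 0) + snd w * b (0, 1))) (at (x, y))"
    using D1[of "(x, y)"] split[of "D1 (x, y)"] unfolding b_def by (metis (no_types, lifting) ext)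
  have Dc: "((\<lambda>w. \<zeta>\<^sub>2 (torus_of w)) has_derivative
      (\<lambda>w. fst w * c (1, 0) + snd w * c (0, 1))) (at (x, y))"
    using D2[of "(x, y)"] split[of "D2 (x, y)"] unfolding c_def by (metis (no_types, lifting) ext)
  have der: "(g has_derivative (\<lambda>(s, t).
      ((1 + 2 * a * cos x + \<delta>\<^sub>1 * b (1, 0)) * s + (a * cos y + \<delta>\<^sub>1 * b (0, 1)) * t,
       (a * cos x + \<delta>\<^sub>2 * c (1, 0)) * s + (1 + 2 * a * cos y + \<delta>\<^sub>2 * c (0, 1)) * t))) (at (x, y))"
    unfolding g_def
    by (rule has_derivative_eq_rhs, (rule derivative_eq_intros Db Dc refl)+)
      (simp add: fun_eq_iff algebra_simps)
  \<comment> \<open>Applied to the two basis vectors, this bounds the matrix entries of the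
    perturbation by operator norms.\<close>
  have ebound: "\<bar>\<delta> * blinfun_apply L w\<bar> \<le> a\<^sup>2 / 100"
    if "\<bar>\<delta>\<bar> * norm L \<le> a\<^sup>2 / 100" "norm w \<le> 1" for \<delta> L and w :: "real \<times> real"
  proof -
    have "\<bar>blinfun_apply L w\<bar> \<le> norm L * 1"
      using norm_blinfun[of L w] that(2) mult_left_mono[OF that(2), of "norm L"] by simp
    then have "\<bar>\<delta>\<bar> * \<bar>blinfun_apply L w\<bar> \<le> \<bar>\<delta>\<bar> * norm L"
      by (intro mult_left_mono) auto
    then show ?thesis using that(1) by (simp add: abs_mult)
  qed
  have "cmod \<mu> \<noteq> 1" if "is_eigenvalue (\<lambda>(s, t).
      ((1 + 2 * a * cos x + \<delta>\<^sub>1 * b (1, 0)) * s + (a * cos y + \<delta>\<^sub>1 * b (0, 1)) * t,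
       (a * cos x + \<delta>\<^sub>2 * c (1, 0)) * s + (1 + 2 * a * cos y + \<delta>\<^sub>2 * c (0, 1)) * t)) \<mu>" for \<mu>
    by (rule perturbed_clock_matrix_hyperbolic[OF a _ cos(1) _ cos(2) _ _ _ _ that])
      (simp_all only: b_def c_def, auto simp: norm_Pair simp del: le_divide_eq_numeral1
        intro!: ebound smallD)
  then show ?thesis
    unfolding hyperbolic_fixed_point_def torus_has_derivative_def
    using fp g der by (intro conjI exI[of _ "(x, y)"] exI) auto
qed

text \<open>The threshold covers every fixed point at once and is chosen before the conjugacy, whose
  image of the centre may be any of them.\<close>

lemma fixed_points_hyperbolic_perturbed:
  assumes a: "0 < a" "a < 1 / 3" and "C1_torus \<zeta>\<^sub>1" and "C1_torus \<zeta>\<^sub>2"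
  obtains \<epsilon> where "\<epsilon> > 0" "\<And>\<delta>\<^sub>1 \<delta>\<^sub>2 q. \<bar>\<delta>\<^sub>1\<bar> + \<bar>\<delta>\<^sub>2\<bar> < \<epsilon> \<Longrightarrow>
    perturbed_clock_map a \<zeta>\<^sub>1 \<zeta>\<^sub>2 \<delta>\<^sub>1 \<delta>\<^sub>2 q = q \<Longrightarrow>
    hyperbolic_fixed_point (perturbed_clock_map a \<zeta>\<^sub>1 \<zeta>\<^sub>2 \<delta>\<^sub>1 \<delta>\<^sub>2) q"
proof -
  obtain M1 D1 where
    1: "\<And>z. ((\<lambda>w. \<zeta>\<^sub>1 (torus_of w)) has_derivative blinfun_apply (D1 z)) (at z)"
    "\<And>w. w \<in> {0..2 * pi} \<times> {0..2 * pi} \<Longrightarrow> \<bar>\<zeta>\<^sub>1 (torus_of w)\<bar> \<le> M1 \<and> norm (D1 w) \<le> M1"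
    using C1_torus_bounds[OF assms(3)] by meson
  obtain M2 D2 where
    2: "\<And>z. ((\<lambda>w. \<zeta>\<^sub>2 (torus_of w)) has_derivative blinfun_apply (D2 z)) (at z)"
    "\<And>w. w \<in> {0..2 * pi} \<times> {0..2 * pi} \<Longrightarrow> \<bar>\<zeta>\<^sub>2 (torus_of w)\<bar> \<le> M2 \<and> norm (D2 w) \<le> M2"
    using C1_torus_bounds[OF assms(4)] by meson
  \<comment> \<open>The summand 1 keeps \<open>M\<close> positive, and the quotient below makes
    \<epsilon> times \<open>M\<close> equal to the tolerance of the matrix estimate.\<close>
  define M where "M = \<bar>M1\<bar> + \<bar>M2\<bar> + 1"
  define \<epsilon> where "\<epsilon> = (a\<^sup>2 / 100) / M"
  have M: "M > 0" "M1 \<le> M" "M2 \<le> M" by (auto simp: M_def)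
  show thesis
  proof (rule that[of \<epsilon>])
    show "\<epsilon> > 0" using a M by (simp add: \<epsilon>_def)
    fix \<delta>\<^sub>1 \<delta>\<^sub>2 q
    assume \<delta>: "\<bar>\<delta>\<^sub>1\<bar> + \<bar>\<delta>\<^sub>2\<bar> < \<epsilon>" and fp: "perturbed_clock_map a \<zeta>\<^sub>1 \<zeta>\<^sub>2 \<delta>\<^sub>1 \<delta>\<^sub>2 q = q"
    obtain x y where q: "0 \<le> x" "x \<le> 2 * pi" "0 \<le> y" "y \<le> 2 * pi" "q = torus_of (x, y)"
      by (rule torus_cases)
    have xy: "(x, y) \<in> {0..2 * pi} \<times> {0..2 * pi}" using q by simp
    have small: "\<bar>\<delta>\<bar> * t \<le> a\<^sup>2 / 100" if "\<bar>\<delta>\<bar> \<le> \<epsilon>" "t \<le> M" "0 \<le> t" for \<delta> t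
    proof -
      have "\<bar>\<delta>\<bar> * t \<le> \<epsilon> * M" using that by (intro mult_mono') auto
      then show ?thesis using M by (simp add: \<epsilon>_def)
    qed
    show "hyperbolic_fixed_point (perturbed_clock_map a \<zeta>\<^sub>1 \<zeta>\<^sub>2 \<delta>\<^sub>1 \<delta>\<^sub>2) q"
      unfolding q(5)
    proof (rule hyperbolic_fixed_point_perturbed[OF a 1(1) 2(1) fp[unfolded q(5)]])
      show "\<bar>\<delta>\<^sub>1 * \<zeta>\<^sub>1 (torus_of (x, y))\<bar> \<le> a\<^sup>2 / 100" "\<bar>\<delta>\<^sub>2 * \<zeta>\<^sub>2 (torus_of (x, y))\<bar> \<le> a\<^sup>2 / 100"
        "\<bar>\<delta>\<^sub>1\<bar> * norm (D1 (x, y)) \<le> a\<^sup>2 / 100" "\<bar>\<delta>\<^sub>2\<bar> * norm (D2 (x, y)) \<le> a\<^sup>2 / 100"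
        using 1(2)[OF xy] 2(2)[OF xy] M \<delta> unfolding abs_mult by (intro small; simp)+
    qed
  qed
qed

theorem theorem10:
  fixes a :: real and \<zeta>\<^sub>1 \<zeta>\<^sub>2 :: "torus \<Rightarrow> real"
  assumes "0 < a" and "a < 1 / 3"
    and "C1_torus \<zeta>\<^sub>1" and "C1_torus \<zeta>\<^sub>2"
  shows "\<exists>\<epsilon>>0. \<forall>\<delta>\<^sub>1 \<delta>\<^sub>2. \<bar>\<delta>\<^sub>1\<bar> + \<bar>\<delta>\<^sub>2\<bar> < \<epsilon> \<longrightarrow>
    (\<forall>h. topological_conjugacy (clock_map a) (perturbed_clock_map a \<zeta>\<^sub>1 \<zeta>\<^sub>2 \<delta>\<^sub>1 \<delta>\<^sub>2) h \<longrightarrow>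
       sink (perturbed_clock_map a \<zeta>\<^sub>1 \<zeta>\<^sub>2 \<delta>\<^sub>1 \<delta>\<^sub>2) (h (torus_of (pi, pi))) \<and>
       strict_lyapunov (perturbed_clock_map a \<zeta>\<^sub>1 \<zeta>\<^sub>2 \<delta>\<^sub>1 \<delta>\<^sub>2) (clock_lyapunov \<circ> inv h)
         (h ` basin (clock_map a) (torus_of (pi, pi))) (h (torus_of (pi, pi))))"
proof -
  obtain \<epsilon> where \<epsilon>: "\<epsilon> > 0" "\<And>\<delta>\<^sub>1 \<delta>\<^sub>2 q. \<bar>\<delta>\<^sub>1\<bar> + \<bar>\<delta>\<^sub>2\<bar> < \<epsilon> \<Longrightarrow>
      perturbed_clock_map a \<zeta>\<^sub>1 \<zeta>\<^sub>2 \<delta>\<^sub>1 \<delta>\<^sub>2 q = q \<Longrightarrow>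
      hyperbolic_fixed_point (perturbed_clock_map a \<zeta>\<^sub>1 \<zeta>\<^sub>2 \<delta>\<^sub>1 \<delta>\<^sub>2) q"
    by (rule fixed_points_hyperbolic_perturbed[OF assms], rule that; blast)
  show ?thesis
  proof (intro exI[of _ \<epsilon>] conjI allI impI)
    fix \<delta>\<^sub>1 \<delta>\<^sub>2 h
    assume \<delta>: "\<bar>\<delta>\<^sub>1\<bar> + \<bar>\<delta>\<^sub>2\<bar> < \<epsilon>"
      and h: "topological_conjugacy (clock_map a) (perturbed_clock_map a \<zeta>\<^sub>1 \<zeta>\<^sub>2 \<delta>\<^sub>1 \<delta>\<^sub>2) h"
    note stable = asymptotically_stable_conjugate[OF h asymptotically_stable_clock_map[OF assms(1,2)]]
    \<comment> \<open>Asymptotic stability includes that the image of the centre is fixed, which is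
      what the hyperbolicity result asks for.\<close>
    then show "sink (perturbed_clock_map a \<zeta>\<^sub>1 \<zeta>\<^sub>2 \<delta>\<^sub>1 \<delta>\<^sub>2) (h (torus_of (pi, pi)))"
      using \<epsilon>(2)[OF \<delta>] by (simp add: sink_def asymptotically_stable_def)
    show "strict_lyapunov (perturbed_clock_map a \<zeta>\<^sub>1 \<zeta>\<^sub>2 \<delta>\<^sub>1 \<delta>\<^sub>2) (clock_lyapunov \<circ> inv h)
        (h ` basin (clock_map a) (torus_of (pi, pi))) (h (torus_of (pi, pi)))"
      by (rule strict_lyapunov_conjugate[OF h strict_lyapunov_clock_map[OF assms(1,2)]])
  qed (rule \<epsilon>(1))
qed

end
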